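(* Let $\mathbb{K}$ be an algebraically closed field of characteristic zero. If a subalgebra $A\subseteq\mathbb{K}[x]$ of codimension three has a spectrum consisting of six elements, then $$A=\{f(x)\mid f(\alpha)=f(\beta),\ f(\gamma)=f(\delta),\ f(\lambda)=f(\mu)\},$$ where $\alpha,\beta,\gamma,\delta,\lambda,\mu$ are pairwise different elements of $\mathbb{K}$. Depending on the relations between them we have the following alternatives. A) If $\alpha+\beta=\gamma+\delta=\lambda+\mu$ then the type of $A$ is $(2,7)$ and a SAGBI basis can be chosen as $$(x-\alpha)(x-\beta),\quad (x-\alpha)^2(x-\beta)(x-\gamma)(x-\delta)(x-\lambda)(x-\mu).$$ If $\Delta=\gamma+\delta-\alpha-\beta\neq0$, let $q(x)=(x-\alpha)(x-\beta)(x-\tau)$ and $p_i(x)=(x-\alpha)^i(x-\beta)(x-\gamma)(x-\delta)$, where $$\tau=\frac{\gamma^2+\gamma\delta+\delta^2+\alpha\beta-(\alpha+\beta)(\gamma+\delta)}{\Delta}.$$ Then: B) If $q(\lambda)=q(\mu)$ and $p_1(\lambda)=p_1(\mu)$ then the type is $(3,4)$ and $p_1,q$ form a SAGBI basis. C) If $q(\lambda)=q(\mu)$ but $p_1(\lambda)\neq p_1(\mu)$ then the type is $(3,5,7)$ and a SAGBI basis can be chosen as $$q,\quad (x-\alpha)(x-\beta)(x-\gamma)(x-\delta)(x-c),\quad (x-\alpha)^2(x-\beta)(x-\gamma)(x-\delta)(x-\lambda)(x-\mu),$$ where the constant $c$ is determined by the condition that the second polynomial $f$ satisfies $f(\lambda)=f(\mu)$.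 D) If $q(\lambda)\neq q(\mu)$ then the type is $(4,5,6,7)$ and a (non-normalized) SAGBI basis can be chosen as $$(q(\lambda)-q(\mu))p_i(x)-(p_i(\lambda)-p_i(\mu))q(x),\quad i=1,2,3,4.$$
   Context: Subalgebras of $\mathbb{K}[x]$ contain all constants; codimension of $A$ is $\dim_{\mathbb{K}}\mathbb{K}[x]/A$. The spectrum $Sp(A)$ of a subalgebra $A$ of finite codimension is the set of $\alpha\in\mathbb{K}$ such that either $f'(\alpha)=0$ for all $f\in A$, or there exists $\beta\neq\alpha$ in $\mathbb{K}$ with $f(\alpha)=f(\beta)$ for all $f\in A$. A SAGBI basis of $A$ is a finite set $G$ of non-constant polynomials in $A$ whose degrees generate the semigroup $S=\{\deg f\mid f\in A\text{ non-constant}\}$. The type $T(A)$ is the ordered list of minimal generators of $S$. *)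

theory Defs
  imports "HOL-Computational_Algebra.Computational_Algebra" "HOL-Library.Set_Algebras"
begin

text \<open>Closure under scalar multiplication is the product with a constant polynomial.\<close>

definition subalgebra :: "'a::comm_ring_1 poly set \<Rightarrow> bool" where
  "subalgebra A \<longleftrightarrow>
     (\<forall>c. [:c:] \<in> A) \<and> (\<forall>f\<in>A. \<forall>g\<in>A. f + g \<in> A) \<and> (\<forall>f\<in>A. \<forall>g\<in>A. f * g \<in> A)"

text \<open>The finite set \<open>B\<close> consists of representatives of the members of a basis of
  the quotient vector space of all polynomials by \<open>A\<close>, whose elements are the cosets
  \<open>f +o A\<close>. Linear independence makes distinct representatives represent distinct cosets,
  so \<open>card B\<close> is the dimension of the quotient.\<close>

definition quotient_basis :: "'a::field poly set \<Rightarrow> 'a poly set \<Rightarrow> bool" where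
  "quotient_basis A B \<longleftrightarrow> finite B \<and>
     (\<forall>c. (\<Sum>b\<in>B. smult (c b) b) +o A = 0 +o A \<longrightarrow> (\<forall>b\<in>B. c b = 0)) \<and>
     (\<forall>f. \<exists>c. f +o A = (\<Sum>b\<in>B. smult (c b) b) +o A)"

definition has_codimension :: "'a::field poly set \<Rightarrow> nat \<Rightarrow> bool" where
  "has_codimension A n \<longleftrightarrow> (\<exists>B. quotient_basis A B \<and> card B = n)"

definition spectrum :: "'a::field poly set \<Rightarrow> 'a set" where
  "spectrum A = {\<alpha>. (\<forall>f\<in>A. poly (pderiv f) \<alpha> = 0) \<or>
                      (\<exists>\<beta>. \<beta> \<noteq> \<alpha> \<and> (\<forall>f\<in>A. poly f \<alpha> = poly f \<beta>))}"

definition degree_semigroup :: "'a::field poly set \<Rightarrow> nat set" where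
  "degree_semigroup A = {degree f | f. f \<in> A \<and> degree f > 0}"

inductive_set semigroup_generated :: "nat set \<Rightarrow> nat set" for D where
  gen: "d \<in> D \<Longrightarrow> d \<in> semigroup_generated D"
| add: "m \<in> semigroup_generated D \<Longrightarrow> n \<in> semigroup_generated D
          \<Longrightarrow> m + n \<in> semigroup_generated D"

definition sagbi_basis :: "'a::field poly set \<Rightarrow> 'a poly set \<Rightarrow> bool" where
  "sagbi_basis A G \<longleftrightarrow> finite G \<and> G \<subseteq> A \<and> (\<forall>g\<in>G. degree g > 0) \<and>
     semigroup_generated (degree ` G) = degree_semigroup A"

definition minimal_generating_set :: "nat set \<Rightarrow> nat set \<Rightarrow> bool" where
  "minimal_generating_set S D \<longleftrightarrow> semigroup_generated D = S \<and>
     (\<forall>E. E \<subset> D \<longrightarrow> semigroup_generated E \<noteq> S)"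

definition is_type :: "'a::field poly set \<Rightarrow> nat list \<Rightarrow> bool" where
  "is_type A ts \<longleftrightarrow> sorted_wrt (<) ts \<and> minimal_generating_set (degree_semigroup A) (set ts)"

text \<open>The description is meaningful because a semigroup of positive integers has only one
  minimal generating set; see \<open>algebra_type_eqI\<close> below.\<close>

definition algebra_type :: "'a::field poly set \<Rightarrow> nat list" where
  "algebra_type A = (THE ts. is_type A ts)"

lemma semigroup_generated_mono:
  assumes "D \<subseteq> E" shows "semigroup_generated D \<subseteq> semigroup_generated E"
proof
  fix x assume "x \<in> semigroup_generated D"
  then show "x \<in> semigroup_generated E"
    by induction (use assms in \<open>auto intro: semigroup_generated.intros\<close>)
qed

lemma semigroup_generated_subset:
  assumes "D \<subseteq> semigroup_generated E" shows "semigroup_generated D \<subseteq> semigroup_generated E"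
proof
  fix x assume "x \<in> semigroup_generated D"
  then show "x \<in> semigroup_generated E"
    by induction (use assms in \<open>auto intro: semigroup_generated.intros\<close>)
qed

lemma minimal_generating_set_eq:
  assumes pos: "0 \<notin> S" and D: "minimal_generating_set S D"
  shows "D = {s \<in> S. \<nexists>a b. a \<in> S \<and> b \<in> S \<and> s = a + b}" (is "D = ?I")
proof -
  have S: "semigroup_generated D = S"
    and min: "\<And>E. E \<subset> D \<Longrightarrow> semigroup_generated E \<noteq> S"
    using D by (auto simp: minimal_generating_set_def)
  have sub: "?I \<subseteq> D"
  proof
    fix s assume s: "s \<in> ?I"
    then have "s \<in> semigroup_generated D" using S by simp
    then show "s \<in> D"
      by cases (use s S in auto)
  qed
  have "s \<in> S \<longrightarrow> s \<in> semigroup_generated ?I" for s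
  proof (induction s rule: less_induct)
    case (less s)
    show ?case
    proof
      assume s: "s \<in> S"
      show "s \<in> semigroup_generated ?I"
      proof (cases "s \<in> ?I")
        case True then show ?thesis by (rule semigroup_generated.gen)
      next
        case False
        then obtain a b where ab: "a \<in> S" "b \<in> S" "s = a + b" using s by auto
        have "a \<noteq> 0" using pos ab(1) by (cases a) simp_all
        moreover have "b \<noteq> 0" using pos ab(2) by (cases b) simp_all
        ultimately have "a < s" "b < s" using ab by auto
        then show ?thesis using less.IH ab by (auto intro: semigroup_generated.add)
      qed
    qed
  qed
  then have "semigroup_generated ?I = S"
    using semigroup_generated_mono[OF sub] S by blast
  then show ?thesis using min sub by blast
qed

lemma algebra_type_eqI:
  assumes "is_type A ts"
  shows "algebra_type A = ts"
  unfolding algebra_type_def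
proof (rule the_equality)
  show "is_type A ts" by (fact assms)
next
  fix us assume us: "is_type A us"
  have 0: "0 \<notin> degree_semigroup A" by (auto simp: degree_semigroup_def)
  have sorted: "sorted_wrt (<) us" "sorted_wrt (<) ts"
    and min: "minimal_generating_set (degree_semigroup A) (set us)"
      "minimal_generating_set (degree_semigroup A) (set ts)"
    using us assms by (simp_all add: is_type_def)
  have "set us = set ts"
    by (rule trans[OF minimal_generating_set_eq[OF 0 min(1)]
          minimal_generating_set_eq[OF 0 min(2), symmetric]])
  then show "us = ts"
    using strict_sorted_equal[OF sorted(2) sorted(1)] by simp
qed

end

theory Submission
  imports Defs
begin

text \<open>
Everything rests on counting dimensions in the quotient by \<open>A\<close>, where independent families are
no longer than spanning ones (\<open>independent_modulo_card_le\<close>).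

An upper bound on the spectrum comes from functionals that vanish on \<open>A\<close>. A class of \<open>k \<ge> 2\<close>
spectral points with equal values under \<open>A\<close> gives \<open>k - 1\<close> independent functionals, and a lone
spectral point gives the derivative there. Codimension three allows only three functionals, so six
points must form three classes of two; the three equalities then cut out a space of
codimension three containing \<open>A\<close>, which is therefore \<open>A\<close> itself (\<open>spectrum_maximal_imp_pairs\<close>).
Explicit polynomials dual to the functionals are easily written down, as products of
\<open>(x - t)\<^sup>2\<close> over the other spectral points \<open>t\<close>, with one more simple factor for a derivative.

A bound on the degrees comes from monomials. If \<open>A\<close> attains all degrees outside a finite set \<open>N\<close>,
the monomials \<open>x\<^sup>n\<close> with \<open>n \<in> N\<close> span the quotient, so \<open>N\<close> has at least three members. Hence,
as soon as some members of \<open>A\<close> have degrees that generate a numerical semigroup with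
exactly three gaps, that semigroup is the whole degree semigroup and those members are a SAGBI
basis (\<open>degree_semigroup_eqI\<close>, \<open>type_and_sagbi_basisI\<close>). The semigroups generated by
\<open>2, 7\<close>, by \<open>3, 4\<close>, by \<open>3, 5, 7\<close> and by \<open>4, 5, 6, 7\<close> all have three gaps. It remains to see that the
listed polynomials lie in \<open>A\<close>. Most of this is visible from their roots; the rest is the
symmetry of a quadratic that exchanges its roots (\<open>quadratic_eq_of_equal_sums\<close>) and the choice of \<open>\<tau>\<close>
as the third root that makes the cubic \<open>q\<close> agree at \<open>\<gamma>\<close> and \<open>\<delta>\<close>
(\<open>cubic_eq_of_third_root\<close>).
\<close>

section \<open>Linear algebra modulo a subspace of polynomials\<close>

interpretation polys: vector_space "smult :: 'a::field \<Rightarrow> 'a poly \<Rightarrow> 'a poly"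
  by unfold_locales (simp_all add: smult_add_right smult_add_left)

text \<open>Families are indexed, so that a repeated member counts as a linear dependence.\<close>

definition independent_modulo :: "'a::field poly set \<Rightarrow> 'i set \<Rightarrow> ('i \<Rightarrow> 'a poly) \<Rightarrow> bool" where
  "independent_modulo A I g \<longleftrightarrow>
     (\<forall>c. (\<Sum>i\<in>I. smult (c i) (g i)) \<in> A \<longrightarrow> (\<forall>i\<in>I. c i = 0))"

definition spanning_modulo :: "'a::field poly set \<Rightarrow> 'i set \<Rightarrow> ('i \<Rightarrow> 'a poly) \<Rightarrow> bool" where
  "spanning_modulo A I g \<longleftrightarrow> (\<forall>f. \<exists>c. f - (\<Sum>i\<in>I. smult (c i) (g i)) \<in> A)"

lemma subalgebra_imp_subspace:
  fixes A :: "'a::field poly set"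
  assumes "subalgebra A"
  shows "polys.subspace A"
proof (rule polys.subspaceI)
  show "0 \<in> A" using assms unfolding subalgebra_def by (metis pCons_0_0)
  show "x + y \<in> A" if "x \<in> A" "y \<in> A" for x y
    using assms that by (simp add: subalgebra_def)
  show "smult c x \<in> A" if "x \<in> A" for c x
  proof -
    have "[:c:] * x \<in> A" using assms that unfolding subalgebra_def by blast
    then show ?thesis by simp
  qed
qed

lemma coset_eq_iff:
  fixes A :: "'a::field poly set"
  assumes A: "polys.subspace A"
  shows "f +o A = g +o A \<longleftrightarrow> f - g \<in> A"
proof
  assume "f +o A = g +o A"
  moreover have "f + 0 \<in> f +o A" using polys.subspace_0[OF A] by (rule set_plus_intro2)
  ultimately obtain a where "a \<in> A" "f = g + a" by (auto simp: elt_set_plus_def)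
  then show "f - g \<in> A" by simp
next
  assume d: "f - g \<in> A"
  have "g + a \<in> f +o A" if "a \<in> A" for a
    using set_plus_intro2[OF polys.subspace_diff[OF A that d], of f] by (simp add: add.commute)
  moreover have "f + a \<in> g +o A" if "a \<in> A" for a
    using set_plus_intro2[OF polys.subspace_add[OF A that d], of g] by (simp add: add.commute)
  ultimately show "f +o A = g +o A" by (auto simp: elt_set_plus_def)
qed

lemma quotient_basis_iff:
  fixes A :: "'a::field poly set"
  assumes A: "polys.subspace A"
  shows "quotient_basis A B \<longleftrightarrow>
    finite B \<and> independent_modulo A B (\<lambda>b. b) \<and> spanning_modulo A B (\<lambda>b. b)"
  by (simp only: quotient_basis_def independent_modulo_def spanning_modulo_def coset_eq_iff[OF A]
      diff_zero)

text \<open>This is the Steinitz bound in the quotient by \<open>A\<close>. The induction removes one spanning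
  element \<open>h j\<close> by adding it to \<open>A\<close>; a family that is independent modulo \<open>A\<close> is then still
  independent modulo the larger space, or becomes so after losing one member.\<close>

lemma independent_modulo_card_le:
  fixes A :: "'a::field poly set"
  assumes "finite J" "polys.subspace A" "finite I"
    and "independent_modulo A I g" "spanning_modulo A J h"
  shows "card I \<le> card J"
  using assms
proof (induction J arbitrary: A I g rule: finite_induct)
  case empty
  have "\<And>f. f \<in> A" using empty.prems(4) by (simp add: spanning_modulo_def)
  then have "\<forall>i\<in>I. (1::'a) = 0"
    using empty.prems(3) unfolding independent_modulo_def by (elim allE[of _ "\<lambda>_. 1"]) auto
  then show ?case by auto
next
  case (insert j J)
  define A' where "A' = {x. \<exists>k. x - smult k (h j) \<in> A}"
  have "A' = polys.span (insert (h j) A)"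
    by (simp add: A'_def polys.span_insert polys.span_eq_iff[THEN iffD2, OF insert.prems(1)])
  then have A': "polys.subspace A'" by simp
  have span': "spanning_modulo A' J h"
    unfolding spanning_modulo_def
  proof
    fix f
    obtain c where "f - (\<Sum>i\<in>insert j J. smult (c i) (h i)) \<in> A"
      using insert.prems(4) unfolding spanning_modulo_def by blast
    then have "(f - (\<Sum>i\<in>J. smult (c i) (h i))) - smult (c j) (h j) \<in> A"
      using insert.hyps by (simp add: algebra_simps)
    then show "\<exists>c. f - (\<Sum>i\<in>J. smult (c i) (h i)) \<in> A'" unfolding A'_def by blast
  qed
  show ?case
  proof (cases "independent_modulo A' I g")
    case True
    then show ?thesis using insert.IH[OF A' insert.prems(2) True span'] insert.hyps by simp
  next
    case False
    then obtain c i0 k where i0: "i0 \<in> I" "c i0 \<noteq> 0"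
      and c: "(\<Sum>i\<in>I. smult (c i) (g i)) - smult k (h j) \<in> A"
      unfolding independent_modulo_def A'_def by blast
    have ind: "\<And>d. (\<Sum>i\<in>I. smult (d i) (g i)) \<in> A \<Longrightarrow> \<forall>i\<in>I. d i = 0"
      using insert.prems(3) unfolding independent_modulo_def by blast
    have k: "k \<noteq> 0" using ind[of c] c i0 by auto
    have "independent_modulo A' (I - {i0}) g"
      unfolding independent_modulo_def
    proof (intro allI impI)
      fix d assume "(\<Sum>i\<in>I - {i0}. smult (d i) (g i)) \<in> A'"
      then obtain l where l: "(\<Sum>i\<in>I - {i0}. smult (d i) (g i)) - smult l (h j) \<in> A"
        unfolding A'_def by blast
      define d' where "d' i = (if i = i0 then 0 else d i)" for i
      have d': "(\<Sum>i\<in>I - {i0}. smult (d i) (g i)) = (\<Sum>i\<in>I. smult (d' i) (g i))"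
        using insert.prems(2) i0 by (intro sum.mono_neutral_cong_left) (auto simp: d'_def)
      have "(\<Sum>i\<in>I. smult (d' i - l / k * c i) (g i)) =
          ((\<Sum>i\<in>I. smult (d' i) (g i)) - smult l (h j))
          - smult (l / k) ((\<Sum>i\<in>I. smult (c i) (g i)) - smult k (h j))"
        using k by (simp add: smult_diff_left smult_diff_right sum_subtractf polys.scale_sum_right)
      also have "\<dots> \<in> A"
        using l c unfolding d'
        by (rule polys.subspace_diff[OF insert.prems(1) _ polys.subspace_scale[OF insert.prems(1)]])
      finally have *: "\<forall>i\<in>I. d' i - l / k * c i = 0" by (rule ind)
      then have "l = 0" using i0 k by (auto simp: d'_def)
      then have "d i = 0" if "i \<in> I - {i0}" for i
        using that *[rule_format, of i] by (simp add: d'_def)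
      then show "\<forall>i\<in>I - {i0}. d i = 0" by blast
    qed
    then have "card (I - {i0}) \<le> card J"
      using insert.IH[OF A' _ _ span'] insert.prems(2) by blast
    then show ?thesis using i0 insert.prems(2) insert.hyps by (simp add: card_Diff_singleton)
  qed
qed

lemma independent_modulo_card_le_codimension:
  assumes "polys.subspace A" "has_codimension A n" "finite I" "independent_modulo A I g"
  shows "card I \<le> n"
  using assms by (auto simp: has_codimension_def quotient_basis_iff intro: independent_modulo_card_le)

lemma codimension_le_card_spanning_modulo:
  assumes "polys.subspace A" "has_codimension A n" "finite J" "spanning_modulo A J h"
  shows "n \<le> card J"
  using assms by (auto simp: has_codimension_def quotient_basis_iff intro: independent_modulo_card_le)

lemma independent_modulo_dual:
  fixes A :: "'a::field poly set"
  assumes I: "finite I"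
    and lin: "\<And>i. i \<in> I \<Longrightarrow> Vector_Spaces.linear smult (*) (L i)"
    and van: "\<And>i f. i \<in> I \<Longrightarrow> f \<in> A \<Longrightarrow> L i f = 0"
    and dual: "\<And>i j. i \<in> I \<Longrightarrow> j \<in> I \<Longrightarrow> L i (g j) = 0 \<longleftrightarrow> i \<noteq> j"
  shows "independent_modulo A I g"
  unfolding independent_modulo_def
proof (intro allI impI ballI)
  fix c i assume c: "(\<Sum>j\<in>I. smult (c j) (g j)) \<in> A" and i: "i \<in> I"
  interpret L: Vector_Spaces.linear smult "(*)" "L i" by (rule lin[OF i])
  have "0 = (\<Sum>j\<in>I. c j * L i (g j))" using van[OF i c] by (simp add: L.sum L.scale)
  also have "\<dots> = c i * L i (g i)"
    using I i dual by (subst sum.remove[of _ i]) (auto intro!: sum.neutral)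
  finally show "c i = 0" using dual[OF i i] by simp
qed

text \<open>A common zero \<open>f\<close> of the functionals outside \<open>A\<close> could be added to the family \<open>g\<close> without
  destroying independence modulo \<open>A\<close>, and that family already has as many members as the
  codimension allows.\<close>

lemma subspace_eq_common_zeros:
  fixes A :: "'a::field poly set"
  assumes A: "polys.subspace A" and codim: "has_codimension A n"
    and I: "finite I" "card I = n"
    and lin: "\<And>i. i \<in> I \<Longrightarrow> Vector_Spaces.linear smult (*) (L i)"
    and van: "\<And>i f. i \<in> I \<Longrightarrow> f \<in> A \<Longrightarrow> L i f = 0"
    and dual: "\<And>i j. i \<in> I \<Longrightarrow> j \<in> I \<Longrightarrow> L i (g j) = 0 \<longleftrightarrow> i \<noteq> j"
  shows "A = {f. \<forall>i\<in>I. L i f = 0}"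
proof (rule antisym)
  show "A \<subseteq> {f. \<forall>i\<in>I. L i f = 0}" using van by blast
next
  show "{f. \<forall>i\<in>I. L i f = 0} \<subseteq> A"
  proof (rule ccontr)
    assume "\<not> ?thesis"
    then obtain f where f: "\<forall>i\<in>I. L i f = 0" "f \<notin> A" by blast
    let ?I = "insert None (Some ` I)"
    have "independent_modulo A ?I (case_option f g)"
      unfolding independent_modulo_def
    proof (intro allI impI)
      fix c assume c: "(\<Sum>j\<in>?I. smult (c j) (case_option f g j)) \<in> A"
      have sum: "(\<Sum>j\<in>?I. smult (c j) (case_option f g j)) =
          smult (c None) f + (\<Sum>j\<in>I. smult (c (Some j)) (g j))"
        using I by (simp add: sum.reindex)
      have zero: "c (Some i) = 0" if i: "i \<in> I" for i
      proof -
        interpret L: Vector_Spaces.linear smult "(*)" "L i" by (rule lin[OF i])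
        have "0 = c None * L i f + (\<Sum>j\<in>I. c (Some j) * L i (g j))"
          using van[OF i c] unfolding sum by (simp add: L.sum L.scale L.add)
        also have "\<dots> = c (Some i) * L i (g i)"
          using I i dual f(1) by (subst sum.remove[of _ i]) (auto intro!: sum.neutral)
        finally show ?thesis using dual[OF i i] by simp
      qed
      then have "smult (c None) f \<in> A" using c unfolding sum by simp
      moreover have "f = smult (inverse (c None)) (smult (c None) f)" if "c None \<noteq> 0"
        using that by simp
      ultimately have "c None = 0" using f(2) polys.subspace_scale[OF A] by metis
      then show "\<forall>i\<in>?I. c i = 0" using zero by auto
    qed
    moreover have "card ?I = Suc n" using I by (simp add: card_image)
    moreover have "finite ?I" using I by simp
    ultimately have "Suc n \<le> n" using independent_modulo_card_le_codimension[OF A codim] by metis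
    then show False by simp
  qed
qed

section \<open>Subalgebras with a spectrum of maximal size\<close>

text \<open>Choose one representative in every class of points that \<open>A\<close> does not separate. A point that
  is not a representative gives the functional \<open>f s - f (\<rho> s)\<close>, a spectral point that is alone in
  its class gives the functional \<open>f' s\<close>. All these functionals vanish on \<open>A\<close> and are
  independent, so there are at most \<open>n\<close> of them. A class of \<open>k\<close> points contributes
  \<open>k - 1\<close> functionals, or one if \<open>k = 1\<close>, hence at least \<open>k / 2\<close>, with equality only for
  \<open>k = 2\<close>. With \<open>2 * n\<close> points equality must hold for every class.\<close>

lemma spectrum_maximal_imp_pairs:
  fixes A :: "'a::field poly set"
  assumes A: "subalgebra A" and codim: "has_codimension A n"
    and fin: "finite (spectrum A)" and card: "card (spectrum A) = 2 * n"
  obtains P \<rho> where "finite P" "card P = n" "inj_on \<rho> P" "\<rho> ` P \<inter> P = {}"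
    "A = {f. \<forall>s\<in>P. poly f s = poly f (\<rho> s)}"
proof -
  define S where "S = spectrum A"
  define same where "same a b \<longleftrightarrow> (\<forall>f\<in>A. poly f a = poly f b)" for a b
  define \<rho> where "\<rho> s = (SOME b. b \<in> S \<and> same s b)" for s
  define R where "R = \<rho> ` S"
  define P where "P = S - R"
  define Q where "Q = {s \<in> R. \<forall>b. same s b \<longrightarrow> b = s}"
  have sub: "polys.subspace A" using A by (rule subalgebra_imp_subspace)
  have \<rho>: "\<rho> s \<in> S \<and> same s (\<rho> s)" if "s \<in> S" for s
    unfolding \<rho>_def by (rule someI[of _ s]) (use that in \<open>simp add: same_def\<close>)
  have \<rho>_eq: "\<rho> s = \<rho> t" if "same s t" for s t
  proof -
    have "(\<lambda>b. b \<in> S \<and> same s b) = (\<lambda>b. b \<in> S \<and> same t b)"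
      using that by (auto simp: same_def)
    then show ?thesis unfolding \<rho>_def by simp
  qed
  have R_fix: "\<rho> r = r" if r: "r \<in> R" for r
  proof -
    obtain s where s: "s \<in> S" "r = \<rho> s" using r by (auto simp: R_def)
    then have "same s r" using \<rho> by blast
    then show ?thesis using \<rho>_eq[of s r] s by simp
  qed
  have RS: "R \<subseteq> S" using \<rho> by (auto simp: R_def)
  have finS: "finite S" using fin by (simp add: S_def)
  have fins: "finite R" "finite P" "finite Q"
    using finS by (auto simp: P_def Q_def R_def)
  have QR: "Q \<subseteq> R" by (auto simp: Q_def)
  have PQ: "P \<inter> Q = {}" using QR by (auto simp: P_def)
  have PQS: "s \<in> S" if "s \<in> P \<union> Q" for s using that QR RS by (auto simp: P_def)
  have \<rho>P: "\<rho> s \<in> R" "\<rho> s \<noteq> s" if "s \<in> P" for s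
    using that by (auto simp: P_def R_def) (metis imageI)
  have cover: "R - Q \<subseteq> \<rho> ` P"
  proof
    fix r assume r: "r \<in> R - Q"
    then obtain b where b: "same r b" "b \<noteq> r" by (auto simp: Q_def)
    have "b \<in> S"
      unfolding S_def spectrum_def using b by (auto simp: same_def)
    moreover have "\<rho> b = r" using \<rho>_eq[OF b(1)] R_fix r by simp
    moreover have "b \<notin> R" using R_fix[of b] \<open>\<rho> b = r\<close> b by auto
    ultimately show "r \<in> \<rho> ` P" by (auto simp: P_def)
  qed

  (* The squares in u make g t and its derivative vanish at every other point of the spectrum; for t
     in Q the extra factor exchanges a nonzero value at t for a nonzero derivative. *)
  define L where "L s f = (if s \<in> Q then poly (pderiv f) s else poly f s - poly f (\<rho> s))" for s f
  define u where "u s = (\<Prod>t\<in>S - {s}. [:-t, 1:] ^ 2)" for s :: 'a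
  define g where "g s = (if s \<in> Q then [:-s, 1:] else 1) * u s" for s
  have u_self: "poly (u s) s \<noteq> 0" for s using finS by (auto simp: u_def poly_prod)
  have u_dvd: "[:-t, 1:] ^ 2 dvd u s" if "t \<in> S" "t \<noteq> s" for s t
    unfolding u_def by (rule dvd_prodI) (use that finS in auto)
  have u_zero: "poly (u s) t = 0" if "t \<in> S" "t \<noteq> s" for s t
    using u_dvd[OF that] by (auto simp: dvd_def)
  have pderiv_zero: "poly (pderiv f) t = 0" if dvd: "[:-t, 1:] ^ 2 dvd f" for f and t :: 'a
  proof -
    obtain h where "f = [:-t, 1:] ^ 2 * h" using dvd by (elim dvdE)
    then show ?thesis
      by (simp add: power2_eq_square mult.assoc pderiv_mult del: mult_pCons_left mult_pCons_right)
  qed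
  have lin: "Vector_Spaces.linear smult (*) (L s)" for s
    by (simp add: L_def Vector_Spaces.linear_iff polys.vector_space_axioms pderiv_add pderiv_smult
        right_diff_distrib) (unfold_locales, simp_all add: algebra_simps)
  have van: "L s f = 0" if s: "s \<in> P \<union> Q" and f: "f \<in> A" for s f
  proof (cases "s \<in> Q")
    case True
    then have "s \<in> spectrum A" using PQS s by (simp add: S_def)
    moreover have "\<not> (\<exists>b. b \<noteq> s \<and> (\<forall>f\<in>A. poly f s = poly f b))"
      using True by (auto simp: Q_def same_def)
    ultimately show ?thesis using f True by (auto simp: spectrum_def L_def)
  next
    case False
    then show ?thesis using \<rho>[OF PQS[OF s]] f by (simp add: L_def same_def)
  qed
  have dual: "L s (g t) = 0 \<longleftrightarrow> s \<noteq> t" if s: "s \<in> P \<union> Q" and t: "t \<in> P \<union> Q" for s t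
  proof (cases "s = t")
    case True
    show ?thesis
    proof (cases "s \<in> Q")
      case sQ: True
      then show ?thesis
        using True u_self[of s] by (simp add: L_def g_def pderiv_mult pderiv_pCons
            del: mult_pCons_left mult_pCons_right)
    next
      case False
      then have "s \<in> P" using s by simp
      then have "poly (g s) (\<rho> s) = 0" using u_zero[of "\<rho> s" s] \<rho>P RS by (auto simp: g_def)
      then show ?thesis using True False u_self[of s] by (simp add: L_def g_def)
    qed
  next
    case False
    show ?thesis
    proof (cases "s \<in> Q")
      case True
      have "[:-s, 1:] ^ 2 dvd g t"
        unfolding g_def by (rule dvd_mult, rule u_dvd) (use PQS[OF s] False in auto)
      then show ?thesis using pderiv_zero True False by (simp add: L_def)
    next
      case sQ: False
      then have sP: "s \<in> P" using s by simp
      have "poly (g t) (\<rho> s) = 0"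
      proof (cases "\<rho> s = t")
        case True
        then have "t \<in> Q" using t \<rho>P[OF sP] by (auto simp: P_def)
        then show ?thesis using True by (simp add: g_def)
      next
        case False
        then show ?thesis using u_zero[of "\<rho> s" t] \<rho>P(1)[OF sP] RS by (auto simp: g_def)
      qed
      moreover have "poly (g t) s = 0" using u_zero[of s t] PQS[OF s] False by (simp add: g_def)
      ultimately show ?thesis using False sQ by (simp add: L_def)
    qed
  qed

  have "card (P \<union> Q) \<le> n"
    using independent_modulo_dual[of "P \<union> Q" L A g] lin van dual fins
    by (intro independent_modulo_card_le_codimension[OF sub codim]) auto
  then have le: "card P + card Q \<le> n" using fins PQ by (simp add: card_Un_disjoint)
  have "card S = card P + card R"
    using finS RS fins by (simp add: P_def card_Diff_subset card_mono)
  moreover have "card R = card Q + card (R - Q)"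
    using QR fins by (simp add: card_Diff_subset card_mono)
  moreover have "card (R - Q) \<le> card (\<rho> ` P)" using cover fins by (simp add: card_mono)
  moreover have "card (\<rho> ` P) \<le> card P" using fins by (simp add: card_image_le)
  ultimately have eqs: "card P = n" "card Q = 0" "card (\<rho> ` P) = card P"
    using card le unfolding S_def by linarith+
  have Q: "Q = {}" using eqs fins by simp
  show thesis
  proof
    show "finite P" "card P = n" using fins eqs by simp_all
    show "inj_on \<rho> P" using eqs fins by (simp add: eq_card_imp_inj_on)
    show "\<rho> ` P \<inter> P = {}" using \<rho>P by (auto simp: P_def)
    have "A = {f. \<forall>s\<in>P. L s f = 0}"
      by (rule subspace_eq_common_zeros[OF sub codim, where g = g])
        (use fins eqs lin van dual in auto)
    then show "A = {f. \<forall>s\<in>P. poly f s = poly f (\<rho> s)}" by (simp add: L_def Q)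
  qed
qed

section \<open>Degree semigroups\<close>

lemma semigroup_generated_eqI:
  assumes "D \<subseteq> T" "0 \<notin> D"
    and add: "\<And>a b. a \<in> T \<Longrightarrow> b \<in> T \<Longrightarrow> a + b \<in> T"
    and decomp: "\<And>k. k \<in> T \<Longrightarrow> k \<in> D \<or> (\<exists>d\<in>D. \<exists>e\<in>T. k = d + e)"
  shows "semigroup_generated D = T"
proof
  show "semigroup_generated D \<subseteq> T"
  proof
    fix k assume "k \<in> semigroup_generated D"
    then show "k \<in> T" by induction (use assms(1) add in auto)
  qed
next
  have "k \<in> T \<Longrightarrow> k \<in> semigroup_generated D" for k
  proof (induction k rule: less_induct)
    case (less k)
    consider "k \<in> D" | d e where "d \<in> D" "e \<in> T" "k = d + e" using decomp[OF less.prems] by blast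
    then show ?case
    proof cases
      case 1
      then show ?thesis by (rule semigroup_generated.gen)
    next
      case 2
      then have "e < k" using assms(2) by (cases d) auto
      then show ?thesis
        using 2 less.IH by (auto intro: semigroup_generated.intros)
    qed
  qed
  then show "T \<subseteq> semigroup_generated D" by blast
qed

lemma degree_semigroup_add:
  fixes A :: "'a::field poly set"
  assumes "subalgebra A" "a \<in> degree_semigroup A" "b \<in> degree_semigroup A"
  shows "a + b \<in> degree_semigroup A"
proof -
  obtain f g where "f \<in> A" "degree f = a" "a > 0" "g \<in> A" "degree g = b" "b > 0"
    using assms(2,3) by (auto simp: degree_semigroup_def)
  moreover from this have "f * g \<in> A" "degree (f * g) = a + b"
    using assms(1) by (auto simp: subalgebra_def intro!: degree_mult_eq)
  ultimately show ?thesis unfolding degree_semigroup_def by force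
qed

lemma semigroup_generated_subset_degree_semigroup:
  fixes A :: "'a::field poly set"
  assumes A: "subalgebra A" and "D \<subseteq> degree_semigroup A"
  shows "semigroup_generated D \<subseteq> degree_semigroup A"
proof
  fix k assume "k \<in> semigroup_generated D"
  then show "k \<in> degree_semigroup A"
    by induction (use assms degree_semigroup_add[OF A] in auto)
qed

text \<open>Subtracting a multiple of \<open>h n\<close>, where \<open>h n\<close> has degree \<open>n\<close>, removes the coefficient of
  \<open>x\<^sup>n\<close> without disturbing higher ones. For \<open>n\<close> outside \<open>N\<close> such an \<open>h n\<close> exists in \<open>A\<close>, for
  \<open>n\<close> in \<open>N\<close> the monomial serves.\<close>

lemma missing_degree_monomials_span:
  fixes A :: "'a::field poly set"
  assumes A: "polys.subspace A" and N: "finite N"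
    and attained: "\<And>n. n \<notin> N \<Longrightarrow> \<exists>f\<in>A. f \<noteq> 0 \<and> degree f = n"
  shows "spanning_modulo A N (\<lambda>n. monom 1 n)"
proof -
  have "\<exists>c. f - (\<Sum>n\<in>N. smult (c n) (monom 1 n)) \<in> A" if "\<And>i. i \<ge> k \<Longrightarrow> coeff f i = 0" for k f
    using that
  proof (induction k arbitrary: f)
    case 0
    then have "f = 0" by (simp add: poly_eq_iff)
    then show ?case by (intro exI[of _ "\<lambda>_. 0"]) (simp add: polys.subspace_0[OF A])
  next
    case (Suc k)
    show ?case
    proof (cases "k \<in> N")
      case True
      have "coeff (f - monom (coeff f k) k) i = 0" if "i \<ge> k" for i
        using Suc.prems[of i] that by (cases "i = k") auto
      from Suc.IH[OF this] obtain c
        where c: "f - monom (coeff f k) k - (\<Sum>n\<in>N. smult (c n) (monom 1 n)) \<in> A" by blast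
      let ?c = "c(k := c k + coeff f k)"
      have "(\<Sum>n\<in>N. smult (?c n) (monom 1 n)) =
          (\<Sum>n\<in>N. smult (c n) (monom 1 n) + (if n = k then monom (coeff f k) k else 0))"
        by (intro sum.cong) (auto simp: smult_monom add_monom)
      also have "\<dots> = (\<Sum>n\<in>N. smult (c n) (monom 1 n)) + monom (coeff f k) k"
        using True N by (simp add: sum.distrib)
      finally have eq: "(\<Sum>n\<in>N. smult (?c n) (monom 1 n)) =
          (\<Sum>n\<in>N. smult (c n) (monom 1 n)) + monom (coeff f k) k" .
      show ?thesis by (rule exI[of _ ?c], unfold eq) (use c in \<open>simp add: algebra_simps\<close>)
    next
      case False
      then obtain h where h: "h \<in> A" "h \<noteq> 0" "degree h = k" using attained by blast
      let ?h = "smult (coeff f k / lead_coeff h) h"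
      have "coeff (f - ?h) i = 0" if "i \<ge> k" for i
        using Suc.prems[of i] h that by (cases "i = k") (auto simp: coeff_eq_0)
      from Suc.IH[OF this] obtain c
        where c: "f - ?h - (\<Sum>n\<in>N. smult (c n) (monom 1 n)) \<in> A" by blast
      have "f - (\<Sum>n\<in>N. smult (c n) (monom 1 n)) =
          (f - ?h - (\<Sum>n\<in>N. smult (c n) (monom 1 n))) + ?h" by simp
      also have "\<dots> \<in> A"
        using c h(1) by (intro polys.subspace_add[OF A] polys.subspace_scale[OF A])
      finally show ?thesis by blast
    qed
  qed
  moreover have "\<And>i. i \<ge> Suc (degree f) \<Longrightarrow> coeff f i = 0" for f :: "'a poly"
    by (simp add: coeff_eq_0)
  ultimately show ?thesis unfolding spanning_modulo_def by blast
qed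

text \<open>The semigroup of \<open>A\<close> has at least as many gaps as the codimension \<open>card N\<close>, because the
  monomials at its gaps span the quotient. Once all degrees outside \<open>N\<close> are attained, no degree
  in \<open>N\<close> can be attained as well.\<close>

lemma degree_semigroup_eqI:
  fixes A :: "'a::field poly set"
  assumes A: "subalgebra A" and codim: "has_codimension A (card N)"
    and N: "finite N" "0 \<notin> N"
    and attained: "{k. 0 < k \<and> k \<notin> N} \<subseteq> degree_semigroup A"
  shows "degree_semigroup A = {k. 0 < k \<and> k \<notin> N}"
proof (rule ccontr)
  assume "\<not> ?thesis"
  then obtain k where k: "k \<in> degree_semigroup A" "k \<in> N"
    using attained by (auto simp: degree_semigroup_def)
  have "\<exists>f\<in>A. f \<noteq> 0 \<and> degree f = n" if n: "n \<notin> N - {k}" for n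
  proof (cases "n = 0")
    case True
    have "[:1:] \<in> A" using A unfolding subalgebra_def by blast
    then show ?thesis using True by (intro bexI[of _ "[:1:]"]) auto
  next
    case False
    then have "n \<in> degree_semigroup A" using n k attained by auto
    then obtain f where "f \<in> A" "degree f = n" by (auto simp: degree_semigroup_def)
    then show ?thesis using False by (intro bexI[of _ f]) auto
  qed
  then have "spanning_modulo A (N - {k}) (\<lambda>n. monom 1 n)"
    using N by (intro missing_degree_monomials_span subalgebra_imp_subspace[OF A]) auto
  then have "card N \<le> card (N - {k})"
    using codimension_le_card_spanning_modulo[OF subalgebra_imp_subspace[OF A] codim] N by blast
  moreover have "card (N - {k}) < card N" using N(1) k(2) by (rule card_Diff1_less)
  ultimately show False by simp
qed

lemma type_and_sagbi_basisI:
  fixes A :: "'a::field poly set"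
  assumes A: "subalgebra A" and codim: "has_codimension A (card N)"
    and N: "finite N" "0 \<notin> N"
    and G: "finite G" "G \<subseteq> A" "degree ` G = set ts" and ts: "sorted_wrt (<) ts"
    and gen: "semigroup_generated (set ts) = {k. 0 < k \<and> k \<notin> N}"
    and irred: "\<And>a b. 0 < a \<Longrightarrow> a \<notin> N \<Longrightarrow> 0 < b \<Longrightarrow> b \<notin> N \<Longrightarrow> a + b \<notin> set ts"
  shows "algebra_type A = ts \<and> sagbi_basis A G"
proof -
  have pos: "0 < k" if "k \<in> set ts" for k
    using semigroup_generated.gen[OF that] gen by auto
  then have G_pos: "\<forall>g\<in>G. degree g > 0" using G(3) by blast
  have "degree ` G \<subseteq> degree_semigroup A"
    using G(2) G_pos by (auto simp: degree_semigroup_def)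
  then have "semigroup_generated (set ts) \<subseteq> degree_semigroup A"
    using semigroup_generated_subset_degree_semigroup[OF A] G(3) by metis
  then have deg: "degree_semigroup A = semigroup_generated (set ts)"
    using degree_semigroup_eqI[OF A codim N] gen by simp
  have "semigroup_generated E \<noteq> semigroup_generated (set ts)" if E: "E \<subset> set ts" for E
  proof
    assume eq: "semigroup_generated E = semigroup_generated (set ts)"
    obtain d where d: "d \<in> set ts" "d \<notin> E" using E by blast
    then have "d \<in> semigroup_generated E" unfolding eq by (intro semigroup_generated.gen)
    then show False by cases (use d irred eq gen in auto)
  qed
  then have "is_type A ts" using ts by (simp add: is_type_def minimal_generating_set_def deg)
  then show ?thesis using G G_pos deg by (auto simp: sagbi_basis_def intro: algebra_type_eqI)
qed

section \<open>Subalgebras defined by three equalities\<close>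

lemma semigroup_2_7: "semigroup_generated {2, 7} = {k. 0 < k \<and> k \<notin> {1, 3, 5}}"
proof (rule semigroup_generated_eqI)
  fix k :: nat assume k: "k \<in> {k. 0 < k \<and> k \<notin> {1, 3, 5}}"
  then consider "k = 2" | "k = 7" | "k = 2 + (k - 2)" "k - 2 \<in> {k. 0 < k \<and> k \<notin> {1, 3, 5}}"
    by force
  then show "k \<in> {2, 7} \<or> (\<exists>d\<in>{2, 7}. \<exists>e\<in>{k. 0 < k \<and> k \<notin> {1, 3, 5}}. k = d + e)"
    by cases blast+
qed (auto; presburger)+

lemma semigroup_3_4: "semigroup_generated {3, 4} = {k. 0 < k \<and> k \<notin> {1, 2, 5}}"
proof (rule semigroup_generated_eqI)
  fix k :: nat assume k: "k \<in> {k. 0 < k \<and> k \<notin> {1, 2, 5}}"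
  then consider "k = 3" | "k = 4" | "k = 4 + 4"
    | "k = 3 + (k - 3)" "k - 3 \<in> {k. 0 < k \<and> k \<notin> {1, 2, 5}}"
    by force
  then show "k \<in> {3, 4} \<or> (\<exists>d\<in>{3, 4}. \<exists>e\<in>{k. 0 < k \<and> k \<notin> {1, 2, 5}}. k = d + e)"
    by cases (blast, blast, force, blast)
qed (auto; presburger)+

lemma semigroup_3_5_7: "semigroup_generated {3, 5, 7} = {k. 0 < k \<and> k \<notin> {1, 2, 4}}"
proof (rule semigroup_generated_eqI)
  fix k :: nat assume k: "k \<in> {k. 0 < k \<and> k \<notin> {1, 2, 4}}"
  then consider "k = 3" | "k = 5" | "k = 7"
    | "k = 3 + (k - 3)" "k - 3 \<in> {k. 0 < k \<and> k \<notin> {1, 2, 4}}"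
    by force
  then show "k \<in> {3, 5, 7} \<or> (\<exists>d\<in>{3, 5, 7}. \<exists>e\<in>{k. 0 < k \<and> k \<notin> {1, 2, 4}}. k = d + e)"
    by cases blast+
qed (auto; presburger)+

lemma semigroup_4_5_6_7: "semigroup_generated {4, 5, 6, 7} = {k. 0 < k \<and> k \<notin> {1, 2, 3}}"
proof (rule semigroup_generated_eqI)
  fix k :: nat assume k: "k \<in> {k. 0 < k \<and> k \<notin> {1, 2, 3}}"
  then consider "k \<in> {4, 5, 6, 7}" | "k = 4 + (k - 4)" "k - 4 \<in> {k. 0 < k \<and> k \<notin> {1, 2, 3}}"
    by force
  then show "k \<in> {4, 5, 6, 7} \<or>
      (\<exists>d\<in>{4, 5, 6, 7}. \<exists>e\<in>{k. 0 < k \<and> k \<notin> {1, 2, 3}}. k = d + e)"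
    by cases blast+
qed (auto; presburger)+

text \<open>The substitution of \<open>a + b - x\<close> for \<open>x\<close> leaves \<open>(x - a) * (x - b)\<close> unchanged, and it exchanges
  \<open>c\<close> and \<open>d\<close> when the sums are equal.\<close>

lemma quadratic_eq_of_equal_sums:
  fixes a b c d :: "'a::comm_ring_1"
  assumes "a + b = c + d"
  shows "(c - a) * (c - b) = (d - a) * (d - b)"
proof -
  have "(c - a) * (c - b) - (d - a) * (d - b) = (c - d) * (c + d - (a + b))"
    by (simp add: algebra_simps)
  then show ?thesis using assms by simp
qed

text \<open>The difference of the two sides is \<open>c - d\<close> times a polynomial that is linear in the third
  root \<open>\<tau>\<close> with leading coefficient \<open>a + b - c - d\<close>; the given \<open>\<tau>\<close> is its zero.\<close>

lemma cubic_eq_of_third_root: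
  fixes a b c d :: "'a::field"
  assumes "c + d - a - b \<noteq> 0"
    and \<tau>: "\<tau> = (c^2 + c * d + d^2 + a * b - (a + b) * (c + d)) / (c + d - a - b)"
  shows "(c - a) * (c - b) * (c - \<tau>) = (d - a) * (d - b) * (d - \<tau>)"
proof -
  have "\<tau> * (c + d - a - b) = c^2 + c * d + d^2 + a * b - (a + b) * (c + d)"
    using assms by simp
  moreover have "(c - a) * (c - b) * (c - \<tau>) - (d - a) * (d - b) * (d - \<tau>) =
      (c - d) * (c^2 + c * d + d^2 + a * b - (a + b) * (c + d) - \<tau> * (c + d - a - b))"
    by (simp add: algebra_simps power2_eq_square)
  ultimately show ?thesis by simp
qed

locale three_pairs =
  fixes A :: "'a::field poly set" and a b c d l m :: 'a
  assumes subalgebra: "subalgebra A" and codim: "has_codimension A 3"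
    and dist: "distinct [a, b, c, d, l, m]"
    and A_eq: "A = {f. poly f a = poly f b \<and> poly f c = poly f d \<and> poly f l = poly f m}"
begin

(* Polynomials stay factorized, so that degrees and values can be read off from the factors. *)
declare mult_pCons_left [simp del] mult_pCons_right [simp del]

text \<open>In every case it is enough to exhibit members of \<open>A\<close> whose degrees generate a semigroup with
  exactly three gaps.\<close>

lemma type_and_sagbi:
  assumes "card N = 3" "0 \<notin> N" "finite G" "G \<subseteq> A" "degree ` G = set ts" "sorted_wrt (<) ts"
    and "semigroup_generated (set ts) = {k. 0 < k \<and> k \<notin> N}"
    and "\<And>x y. 0 < x \<Longrightarrow> x \<notin> N \<Longrightarrow> 0 < y \<Longrightarrow> y \<notin> N \<Longrightarrow> x + y \<notin> set ts"
  shows "algebra_type A = ts \<and> sagbi_basis A G"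
proof (rule type_and_sagbi_basisI[where N = N])
  show "has_codimension A (card N)" using codim assms(1) by simp
  show "finite N" using assms(1) by (intro card_ge_0_finite) simp
qed (use assms subalgebra in auto)

definition septic :: "'a poly" where
  "septic = [:-a, 1:]^2 * [:-b, 1:] * [:-c, 1:] * [:-d, 1:] * [:-l, 1:] * [:-m, 1:]"

text \<open>Raising the power of \<open>x - a\<close> in the quartic for \<open>i = 1\<close> keeps its four zeros and supplies
  every degree from four on.\<close>

definition quartic :: "nat \<Rightarrow> 'a poly" where
  "quartic i = [:-a, 1:]^i * [:-b, 1:] * [:-c, 1:] * [:-d, 1:]"

definition quintic :: "'a \<Rightarrow> 'a poly" where
  "quintic e = [:-a, 1:] * [:-b, 1:] * [:-c, 1:] * [:-d, 1:] * [:-e, 1:]"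

lemma septic_in: "septic \<in> A" and degree_septic: "degree septic = 7"
  by (simp_all add: septic_def A_eq degree_mult_eq degree_power_eq)

lemma degree_quartic: "degree (quartic i) = i + 3"
  by (simp add: quartic_def degree_mult_eq degree_power_eq)

lemma degree_quintic: "degree (quintic e) = 5"
  by (simp add: quintic_def degree_mult_eq)

lemma equal_sums:
  assumes "a + b = c + d" "c + d = l + m"
  shows "algebra_type A = [2, 7] \<and> sagbi_basis A {[:-a, 1:] * [:-b, 1:], septic}"
proof (rule type_and_sagbi[where N = "{1, 3, 5}"])
  have "[:-a, 1:] * [:-b, 1:] \<in> A"
    using assms quadratic_eq_of_equal_sums[of a b c d] quadratic_eq_of_equal_sums[of a b l m]
    by (simp add: A_eq)
  then show "{[:-a, 1:] * [:-b, 1:], septic} \<subseteq> A" using septic_in by simp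
  show "degree ` {[:-a, 1:] * [:-b, 1:], septic} = set [2, 7]"
    by (auto simp: degree_septic degree_mult_eq)
  show "semigroup_generated (set [2, 7]) = {k. 0 < k \<and> k \<notin> {1, 3, 5}}"
    using semigroup_2_7 by simp
  show "x + y \<notin> set [2, 7]" if "0 < x" "x \<notin> {1, 3, 5}" "0 < y" "y \<notin> {1, 3, 5}" for x y :: nat
    using that by simp
qed simp_all

end

locale three_pairs_distinct_sums = three_pairs +
  fixes \<tau> and q :: "'a poly"
  assumes \<Delta>: "c + d - a - b \<noteq> 0"
    and \<tau>: "\<tau> = (c^2 + c * d + d^2 + a * b - (a + b) * (c + d)) / (c + d - a - b)"
    and q: "q = [:-a, 1:] * [:-b, 1:] * [:-\<tau>, 1:]"
begin

lemma degree_q: "degree q = 3"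
  by (simp add: q degree_mult_eq)

lemma poly_q: "poly q a = poly q b" "poly q c = poly q d"
  using cubic_eq_of_third_root[OF \<Delta> \<tau>] by (simp_all add: q)

lemma type_3_4:
  assumes "poly q l = poly q m" "poly (quartic 1) l = poly (quartic 1) m"
  shows "algebra_type A = [3, 4] \<and> sagbi_basis A {quartic 1, q}"
proof (rule type_and_sagbi[where N = "{1, 2, 5}"])
  have "poly (quartic 1) a = poly (quartic 1) b" "poly (quartic 1) c = poly (quartic 1) d"
    by (simp_all add: quartic_def)
  then show "{quartic 1, q} \<subseteq> A" using assms poly_q by (simp add: A_eq)
  show "degree ` {quartic 1, q} = set [3, 4]" by (auto simp: degree_quartic degree_q)
  show "semigroup_generated (set [3, 4]) = {k. 0 < k \<and> k \<notin> {1, 2, 5}}"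
    using semigroup_3_4 by simp
  show "x + y \<notin> set [3, 4]" if "0 < x" "x \<notin> {1, 2, 5}" "0 < y" "y \<notin> {1, 2, 5}" for x y :: nat
    using that by simp
qed simp_all

lemma poly_quintic_eq_iff:
  "poly (quintic e) l = poly (quintic e) m \<longleftrightarrow>
     e * (poly (quartic 1) l - poly (quartic 1) m) =
     l * poly (quartic 1) l - m * poly (quartic 1) m"
proof -
  have eval: "poly (quintic e) x = poly (quartic 1) x * (x - e)" for x
    by (simp add: quintic_def quartic_def)
  have "poly (quintic e) l - poly (quintic e) m =
      (l * poly (quartic 1) l - m * poly (quartic 1) m)
      - e * (poly (quartic 1) l - poly (quartic 1) m)"
    unfolding eval by (simp add: algebra_simps)
  then show ?thesis by (metis right_minus_eq)
qed

lemma ex1_quintic: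
  assumes "poly (quartic 1) l \<noteq> poly (quartic 1) m"
  shows "\<exists>!e. poly (quintic e) l = poly (quintic e) m"
  unfolding poly_quintic_eq_iff
  using assms by (intro ex1I[of _ "(l * poly (quartic 1) l - m * poly (quartic 1) m) /
    (poly (quartic 1) l - poly (quartic 1) m)"]) (simp_all add: eq_divide_eq)

lemma type_3_5_7:
  assumes "poly q l = poly q m" "poly (quintic e) l = poly (quintic e) m"
  shows "algebra_type A = [3, 5, 7] \<and> sagbi_basis A {q, quintic e, septic}"
proof (rule type_and_sagbi[where N = "{1, 2, 4}"])
  have "poly (quintic e) a = poly (quintic e) b" "poly (quintic e) c = poly (quintic e) d"
    by (simp_all add: quintic_def)
  then show "{q, quintic e, septic} \<subseteq> A" using assms poly_q septic_in by (simp add: A_eq)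
  show "degree ` {q, quintic e, septic} = set [3, 5, 7]"
    by (simp add: degree_quintic degree_q degree_septic)
  show "semigroup_generated (set [3, 5, 7]) = {k. 0 < k \<and> k \<notin> {1, 2, 4}}"
    using semigroup_3_5_7 by simp
  show "x + y \<notin> set [3, 5, 7]" if "0 < x" "x \<notin> {1, 2, 4}" "0 < y" "y \<notin> {1, 2, 4}" for x y :: nat
    using that by simp
qed simp_all

text \<open>Here \<open>q\<close> violates the third equality and \<open>quartic i\<close> may violate it too; the combination
  cancels the two defects. Since \<open>q\<close> has the smaller degree and the coefficient of \<open>quartic i\<close>
  is not zero, the degree \<open>i + 3\<close> is kept.\<close>

lemma type_4_5_6_7:
  assumes "poly q l \<noteq> poly q m"
  shows "algebra_type A = [4, 5, 6, 7] \<and>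
    sagbi_basis A ((\<lambda>i. smult (poly q l - poly q m) (quartic i)
      - smult (poly (quartic i) l - poly (quartic i) m) q) ` {1, 2, 3, 4})"
proof (rule type_and_sagbi[where N = "{1, 2, 3}"])
  let ?f = "\<lambda>i. smult (poly q l - poly q m) (quartic i)
      - smult (poly (quartic i) l - poly (quartic i) m) q"
  have "?f i \<in> A" if "i \<ge> 1" for i
  proof -
    have "poly (quartic i) a = poly (quartic i) b" "poly (quartic i) c = poly (quartic i) d"
      using that by (simp_all add: quartic_def)
    then show ?thesis using poly_q by (simp add: A_eq algebra_simps)
  qed
  then show "?f ` {1, 2, 3, 4} \<subseteq> A" by auto
  have deg: "degree (?f i) = i + 3" if "i \<ge> 1" for i
  proof -
    have "degree (smult (poly (quartic i) l - poly (quartic i) m) q)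
        < degree (smult (poly q l - poly q m) (quartic i))"
      using assms that by (simp add: degree_quartic degree_q)
    then have "degree (?f i) = degree (smult (poly q l - poly q m) (quartic i))"
      using degree_add_eq_left[of "- smult (poly (quartic i) l - poly (quartic i) m) q"] by simp
    then show ?thesis using assms by (simp add: degree_quartic)
  qed
  show "degree ` ?f ` {1, 2, 3, 4} = set [4, 5, 6, 7]"
    by (simp add: deg image_image)
  show "semigroup_generated (set [4, 5, 6, 7]) = {k. 0 < k \<and> k \<notin> {1, 2, 3}}"
    using semigroup_4_5_6_7 by simp
  show "x + y \<notin> set [4, 5, 6, 7]" if "0 < x" "x \<notin> {1, 2, 3}" "0 < y" "y \<notin> {1, 2, 3}" for x y :: nat
    using that by simp
qed simp_all

end

lemma spectrum_six_imp_three_pairs: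
  fixes A :: "'a::field poly set"
  assumes "subalgebra A" "has_codimension A 3" "card (spectrum A) = 6"
  obtains a b c d l m where "distinct [a, b, c, d, l, m]"
    "A = {f. poly f a = poly f b \<and> poly f c = poly f d \<and> poly f l = poly f m}"
proof -
  obtain P \<rho> where P: "finite P" "card P = 3" "inj_on \<rho> P" "\<rho> ` P \<inter> P = {}"
    and A: "A = {f. \<forall>s\<in>P. poly f s = poly f (\<rho> s)}"
    using assms by (elim spectrum_maximal_imp_pairs) (auto intro: card_ge_0_finite)
  obtain a c l where acl: "P = {a, c, l}" "a \<noteq> c" "c \<noteq> l" "a \<noteq> l"
    using P(2) by (auto simp: card_3_iff)
  show thesis
  proof
    show "distinct [a, \<rho> a, c, \<rho> c, l, \<rho> l]" using P(3,4) acl by auto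
    show "A = {f. poly f a = poly f (\<rho> a) \<and> poly f c = poly f (\<rho> c) \<and> poly f l = poly f (\<rho> l)}"
      using A acl(1) by simp
  qed
qed

theorem theorem44:
  fixes A :: "'a::{alg_closed_field, field_char_0} poly set"
  assumes "subalgebra A"
    and "has_codimension A 3"
    and "card (spectrum A) = 6"
  shows
    "(\<exists>\<alpha> \<beta> \<gamma> \<delta> l m.
        distinct [\<alpha>, \<beta>, \<gamma>, \<delta>, l, m] \<and>
        A = {f. poly f \<alpha> = poly f \<beta> \<and> poly f \<gamma> = poly f \<delta> \<and> poly f l = poly f m} \<and>
        (\<alpha> + \<beta> = \<gamma> + \<delta> \<and> \<gamma> + \<delta> = l + m \<or> \<gamma> + \<delta> - \<alpha> - \<beta> \<noteq> 0)) \<and>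
     (\<forall>\<alpha> \<beta> \<gamma> \<delta> l m.
        distinct [\<alpha>, \<beta>, \<gamma>, \<delta>, l, m] \<and>
        A = {f. poly f \<alpha> = poly f \<beta> \<and> poly f \<gamma> = poly f \<delta> \<and> poly f l = poly f m} \<longrightarrow>
        (\<alpha> + \<beta> = \<gamma> + \<delta> \<and> \<gamma> + \<delta> = l + m \<longrightarrow>
           algebra_type A = [2, 7] \<and>
           sagbi_basis A
             {[:-\<alpha>, 1:] * [:-\<beta>, 1:],
              [:-\<alpha>, 1:]^2 * [:-\<beta>, 1:] * [:-\<gamma>, 1:] * [:-\<delta>, 1:] * [:-l, 1:] * [:-m, 1:]}) \<and>
        (let \<Delta> = \<gamma> + \<delta> - \<alpha> - \<beta>;
             \<tau> = (\<gamma>^2 + \<gamma> * \<delta> + \<delta>^2 + \<alpha> * \<beta> - (\<alpha> + \<beta>) * (\<gamma> + \<delta>)) / \<Delta>;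
             q = [:-\<alpha>, 1:] * [:-\<beta>, 1:] * [:-\<tau>, 1:];
             p = (\<lambda>i::nat. [:-\<alpha>, 1:]^i * [:-\<beta>, 1:] * [:-\<gamma>, 1:] * [:-\<delta>, 1:]);
             r = (\<lambda>c. [:-\<alpha>, 1:] * [:-\<beta>, 1:] * [:-\<gamma>, 1:] * [:-\<delta>, 1:] * [:-c, 1:])
         in \<Delta> \<noteq> 0 \<longrightarrow>
            (poly q l = poly q m \<and> poly (p 1) l = poly (p 1) m \<longrightarrow>
               algebra_type A = [3, 4] \<and> sagbi_basis A {p 1, q}) \<and>
            (poly q l = poly q m \<and> poly (p 1) l \<noteq> poly (p 1) m \<longrightarrow>
               algebra_type A = [3, 5, 7] \<and>
               (\<exists>!c. poly (r c) l = poly (r c) m) \<and>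
               (\<forall>c. poly (r c) l = poly (r c) m \<longrightarrow>
                  sagbi_basis A
                    {q, r c,
                     [:-\<alpha>, 1:]^2 * [:-\<beta>, 1:] * [:-\<gamma>, 1:] * [:-\<delta>, 1:] * [:-l, 1:] * [:-m, 1:]})) \<and>
            (poly q l \<noteq> poly q m \<longrightarrow>
               algebra_type A = [4, 5, 6, 7] \<and>
               sagbi_basis A
                 ((\<lambda>i. smult (poly q l - poly q m) (p i) - smult (poly (p i) l - poly (p i) m) q)
                  ` {1, 2, 3, 4}))))"
    (is "?structure \<and> (\<forall>\<alpha> \<beta> \<gamma> \<delta> l m. _ \<longrightarrow> ?cases \<alpha> \<beta> \<gamma> \<delta> l m)")
proof (intro conjI[of ?structure] allI impI)
  obtain a b c d l m where dist: "distinct [a, b, c, d, l, m]"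
    and A: "A = {f. poly f a = poly f b \<and> poly f c = poly f d \<and> poly f l = poly f m}"
    using spectrum_six_imp_three_pairs[OF assms] .
  have structureI: ?structure if "distinct [a, b, c, d, l, m]"
    "A = {f. poly f a = poly f b \<and> poly f c = poly f d \<and> poly f l = poly f m}"
    "a + b = c + d \<and> c + d = l + m \<or> c + d - a - b \<noteq> 0" for a b c d l m
    using that by blast
  (* Unless all three sums agree, some pair has a sum different from that of the first pair and
     can be listed second. *)
  show ?structure
  proof (cases "c + d - a - b = 0 \<and> l + m - a - b \<noteq> 0")
    case True
    have "A = {f. poly f a = poly f b \<and> poly f l = poly f m \<and> poly f c = poly f d}"
      unfolding A by blast
    then show ?thesis using dist True by (intro structureI[of a b l m c d]) auto
  next
    case False
    then have "a + b = c + d \<and> c + d = l + m \<or> c + d - a - b \<noteq> 0"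
      by (auto simp: diff_diff_eq)
    then show ?thesis by (rule structureI[OF dist A])
  qed
next
  fix \<alpha> \<beta> \<gamma> \<delta> l m
  assume pairs: "distinct [\<alpha>, \<beta>, \<gamma>, \<delta>, l, m] \<and>
    A = {f. poly f \<alpha> = poly f \<beta> \<and> poly f \<gamma> = poly f \<delta> \<and> poly f l = poly f m}"
  interpret three_pairs A \<alpha> \<beta> \<gamma> \<delta> l m
    by (rule three_pairs.intro[OF assms(1,2) conjunct1[OF pairs] conjunct2[OF pairs]])
  define \<tau> where "\<tau> = (\<gamma>^2 + \<gamma> * \<delta> + \<delta>^2 + \<alpha> * \<beta> - (\<alpha> + \<beta>) * (\<gamma> + \<delta>)) / (\<gamma> + \<delta> - \<alpha> - \<beta>)"
  define q where "q = [:-\<alpha>, 1:] * [:-\<beta>, 1:] * [:-\<tau>, 1:]"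
  have quartic: "quartic = (\<lambda>i. [:-\<alpha>, 1:]^i * [:-\<beta>, 1:] * [:-\<gamma>, 1:] * [:-\<delta>, 1:])"
    by (rule ext) (rule quartic_def)
  have quintic: "quintic =
      (\<lambda>e. [:-\<alpha>, 1:] * [:-\<beta>, 1:] * [:-\<gamma>, 1:] * [:-\<delta>, 1:] * [:-e, 1:])"
    by (rule ext) (rule quintic_def)
  have B: "\<gamma> + \<delta> - \<alpha> - \<beta> \<noteq> 0 \<longrightarrow>
      (poly q l = poly q m \<and> poly (quartic 1) l = poly (quartic 1) m \<longrightarrow>
        algebra_type A = [3, 4] \<and> sagbi_basis A {quartic 1, q}) \<and>
      (poly q l = poly q m \<and> poly (quartic 1) l \<noteq> poly (quartic 1) m \<longrightarrow>
        algebra_type A = [3, 5, 7] \<and> (\<exists>!e. poly (quintic e) l = poly (quintic e) m) \<and>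
        (\<forall>e. poly (quintic e) l = poly (quintic e) m \<longrightarrow> sagbi_basis A {q, quintic e, septic})) \<and>
      (poly q l \<noteq> poly q m \<longrightarrow>
        algebra_type A = [4, 5, 6, 7] \<and>
        sagbi_basis A ((\<lambda>i. smult (poly q l - poly q m) (quartic i)
          - smult (poly (quartic i) l - poly (quartic i) m) q) ` {1, 2, 3, 4}))"
  proof
    assume \<Delta>: "\<gamma> + \<delta> - \<alpha> - \<beta> \<noteq> 0"
    interpret three_pairs_distinct_sums A \<alpha> \<beta> \<gamma> \<delta> l m \<tau> q
      by unfold_locales (fact \<Delta> \<tau>_def q_def)+
    show "(poly q l = poly q m \<and> poly (quartic 1) l = poly (quartic 1) m \<longrightarrow>
        algebra_type A = [3, 4] \<and> sagbi_basis A {quartic 1, q}) \<and>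
      (poly q l = poly q m \<and> poly (quartic 1) l \<noteq> poly (quartic 1) m \<longrightarrow>
        algebra_type A = [3, 5, 7] \<and> (\<exists>!e. poly (quintic e) l = poly (quintic e) m) \<and>
        (\<forall>e. poly (quintic e) l = poly (quintic e) m \<longrightarrow> sagbi_basis A {q, quintic e, septic})) \<and>
      (poly q l \<noteq> poly q m \<longrightarrow>
        algebra_type A = [4, 5, 6, 7] \<and>
        sagbi_basis A ((\<lambda>i. smult (poly q l - poly q m) (quartic i)
          - smult (poly (quartic i) l - poly (quartic i) m) q) ` {1, 2, 3, 4}))"
      using type_3_4 type_3_5_7 ex1_quintic type_4_5_6_7 by blast
  qed
  show "?cases \<alpha> \<beta> \<gamma> \<delta> l m"
    unfolding Let_def
  proof (rule conjI, goal_cases)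
    case 1
    show ?case using equal_sums unfolding septic_def by blast
  next
    case 2
    show ?case using B unfolding septic_def quartic quintic q_def \<tau>_def .
  qed
qed

end
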